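(* Let $p\in[n]^n$ be a parking preference. Then $p$ is a Motzkin parking function if and only if $\Phi(p)$ is a Motzkin path.
   Context: $[n]=\{1,\dots,n\}$. A parking function of length $n$ is $p\in[n]^n$ whose non-decreasing rearrangement $a_1\le\dots\le a_n$ satisfies $a_i\le i$ for all $i$ (equivalently, all cars manage to park in the classical or MVP parking process where car $i$ prefers spot $p_i$). A Motzkin parking function is a parking function in which, for every $j\in[n]$, $|\{i:p_i=j\}|\le 2$. For $p\in[n]^n$, $\Phi(p)=\phi_1\cdots\phi_n$ is the lattice path with steps $\phi_j=U=(1,1)$ if $|\{i:p_i=j\}|\ge2$, $\phi_j=H=(1,0)$ if $|\{i:p_i=j\}|=1$, and $\phi_j=D=(1,-1)$ if $|\{i:p_i=j\}|=0$. A Motzkin path of length $n$ is a lattice path from $(0,0)$ to $(n,0)$ with steps $U,H,D$ that never goes below the $x$-axis. *)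

theory Defs
  imports Main "HOL-Library.Product_Plus"
begin

text \<open>A preference \<open>p = (p\<^sub>1, \<dots>, p\<^sub>n)\<close> is a list; \<open>p\<^sub>i\<close> is \<open>p ! (i - 1)\<close>, as list positions start at 0.\<close>

definition parking_preferences :: "nat \<Rightarrow> nat list set" where
  "parking_preferences n = {p. length p = n \<and> set p \<subseteq> {1..n}}"

definition multiplicity_of :: "nat list \<Rightarrow> nat \<Rightarrow> nat" where
  "multiplicity_of p j = card {i \<in> {1..length p}. p ! (i - 1) = j}"

definition parking_function :: "nat \<Rightarrow> nat list \<Rightarrow> bool" where
  "parking_function n p \<longleftrightarrow>
     p \<in> parking_preferences n \<and> (\<forall>i\<in>{1..n}. sort p ! (i - 1) \<le> i)"

definition motzkin_parking_function :: "nat \<Rightarrow> nat list \<Rightarrow> bool" where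
  "motzkin_parking_function n p \<longleftrightarrow>
     parking_function n p \<and> (\<forall>j\<in>{1..n}. multiplicity_of p j \<le> 2)"

datatype step = U | H | D

fun step_vector :: "step \<Rightarrow> int \<times> int" where
  "step_vector U = (1, 1)"
| "step_vector H = (1, 0)"
| "step_vector D = (1, -1)"

text \<open>The point reached from the origin after the first \<open>k\<close> steps of a lattice path.\<close>

definition path_point :: "step list \<Rightarrow> nat \<Rightarrow> int \<times> int" where
  "path_point w k = sum_list (map step_vector (take k w))"

text \<open>Paths start at the origin by construction. Since steps are straight segments, a path stays
  weakly above the x-axis iff all its lattice points do.\<close>

definition motzkin_path :: "nat \<Rightarrow> step list \<Rightarrow> bool" where
  "motzkin_path n w \<longleftrightarrow>
     path_point w (length w) = (int n, 0) \<and> (\<forall>k\<le>length w. 0 \<le> snd (path_point w k))"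

definition Phi_step :: "nat list \<Rightarrow> nat \<Rightarrow> step" where
  "Phi_step p j =
     (if multiplicity_of p j \<ge> 2 then U else if multiplicity_of p j = 1 then H else D)"

definition Phi :: "nat \<Rightarrow> nat list \<Rightarrow> step list" where
  "Phi n p = map (Phi_step p) [1..<Suc n]"

end

theory Submission
  imports Defs
begin

text \<open>
  Let \<open>m\<^sub>j\<close> be the number of cars preferring spot \<open>j\<close>. The height of \<open>\<Phi>(p)\<close> after \<open>k\<close> steps
  is \<open>\<Sum>\<^bsub>j\<le>k\<^esub> min 2 m\<^sub>j - k\<close>, whereas \<open>p\<close> is a parking function iff \<open>\<Sum>\<^bsub>j\<le>k\<^esub> m\<^sub>j \<ge> k\<close> for
  all \<open>k\<close>. If all \<open>m\<^sub>j \<le> 2\<close>, the two conditions coincide. Conversely, since the \<open>m\<^sub>j\<close> sum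
  to \<open>n\<close>, a path ending at height 0 satisfies \<open>\<Sum> min 2 m\<^sub>j = \<Sum> m\<^sub>j\<close>, which forces
  \<open>m\<^sub>j \<le> 2\<close> for all \<open>j\<close>.
\<close>

lemma sorted_nth_le_iff_less_length_filter:
  fixes xs :: "'a::linorder list"
  assumes "sorted xs" and "i < length xs"
  shows "xs ! i \<le> c \<longleftrightarrow> i < length (filter (\<lambda>x. x \<le> c) xs)"
proof -
  let ?S = "{j. j < length xs \<and> xs ! j \<le> c}"
  have "i < card ?S" if "xs ! i \<le> c"
  proof -
    have "{..i} \<subseteq> ?S"
      using assms that by (auto intro: order_trans[OF sorted_nth_mono])
    then have "card {..i} \<le> card ?S"
      by (intro card_mono) auto
    then show ?thesis by simp
  qed
  moreover have "card ?S \<le> i" if "\<not> xs ! i \<le> c"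
  proof -
    have "j < i" if "j \<in> ?S" for j
    proof (rule ccontr)
      assume "\<not> j < i"
      then have "xs ! i \<le> xs ! j"
        using that assms(1) by (intro sorted_nth_mono) auto
      with that \<open>\<not> xs ! i \<le> c\<close> show False by auto
    qed
    then have "card ?S \<le> card {..<i}"
      by (intro card_mono) auto
    then show ?thesis by simp
  qed
  ultimately show ?thesis
    unfolding length_filter_conv_card by (meson not_less)
qed

lemma sort_nth_le_iff_less_length_filter:
  fixes xs :: "'a::linorder list"
  assumes "i < length xs"
  shows "sort xs ! i \<le> c \<longleftrightarrow> i < length (filter (\<lambda>x. x \<le> c) xs)"
  using sorted_nth_le_iff_less_length_filter[of "sort xs" i c] assms
  by (simp add: filter_sort)

lemma sum_count_list_eq_length_filter:
  assumes "finite A"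
  shows "sum (count_list xs) A = length (filter (\<lambda>x. x \<in> A) xs)"
proof -
  have "sum (count_list xs) A = sum (count_list (filter (\<lambda>x. x \<in> A) xs)) A"
    by (rule sum.cong) (auto simp: count_list_eq_length_filter
        intro!: arg_cong[of _ _ length] filter_cong)
  also have "\<dots> = length (filter (\<lambda>x. x \<in> A) xs)"
    using assms by (intro sum_count_set) auto
  finally show ?thesis .
qed

lemma sum_min_eq_iff:
  fixes f g :: "'a \<Rightarrow> 'b::{linorder, ordered_cancel_comm_monoid_add}"
  assumes "finite A"
  shows "(\<Sum>x\<in>A. min (g x) (f x)) = sum f A \<longleftrightarrow> (\<forall>x\<in>A. f x \<le> g x)"
proof
  assume sum_eq: "(\<Sum>x\<in>A. min (g x) (f x)) = sum f A"
  show "\<forall>x\<in>A. f x \<le> g x"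
  proof
    fix x assume "x \<in> A"
    then have "min (g x) (f x) = f x"
      using sum_mono_inv[OF sum_eq _ _ assms] by simp
    then show "f x \<le> g x" by (simp add: min_def split: if_splits)
  qed
qed (simp add: min_absorb2)

lemma multiplicity_of_eq_count_list: "multiplicity_of p = count_list p"
proof
  fix j
  have "{i \<in> {1..length p}. p ! (i - 1) = j} = Suc ` {i. i < length p \<and> j = p ! i}"
    by (auto simp: image_iff Suc_le_eq gr0_conv_Suc)
  then show "multiplicity_of p j = count_list p j"
    by (simp add: multiplicity_of_def count_list_eq_length_filter length_filter_conv_card card_image)
qed

lemma sum_multiplicity_of_eq_length_filter:
  assumes "p \<in> parking_preferences n"
  shows "sum (multiplicity_of p) {1..k} = length (filter (\<lambda>x. x \<le> k) p)"
proof -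
  have "filter (\<lambda>x. x \<in> {1..k}) p = filter (\<lambda>x. x \<le> k) p"
    using assms by (intro filter_cong) (auto simp: parking_preferences_def)
  then show ?thesis
    by (simp only: multiplicity_of_eq_count_list sum_count_list_eq_length_filter
        finite_atLeastAtMost)
qed

lemma sum_multiplicity_of_eq_length:
  assumes "p \<in> parking_preferences n"
  shows "sum (multiplicity_of p) {1..n} = n"
  using assms sum_count_set[of p "{1..n}"]
  by (simp add: multiplicity_of_eq_count_list parking_preferences_def)

lemma parking_function_iff_le_sum_multiplicity_of:
  assumes "p \<in> parking_preferences n"
  shows "parking_function n p \<longleftrightarrow> (\<forall>k\<le>n. k \<le> sum (multiplicity_of p) {1..k})"
proof -
  have "sort p ! (k - 1) \<le> k \<longleftrightarrow> k \<le> sum (multiplicity_of p) {1..k}" if "k \<in> {1..n}" for k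
  proof -
    have "k - 1 < length p"
      using assms that by (auto simp: parking_preferences_def)
    then have "sort p ! (k - 1) \<le> k \<longleftrightarrow> k - 1 < sum (multiplicity_of p) {1..k}"
      by (simp only: sort_nth_le_iff_less_length_filter
          sum_multiplicity_of_eq_length_filter[OF assms])
    with that show ?thesis by auto
  qed
  then have "parking_function n p \<longleftrightarrow> (\<forall>k\<in>{1..n}. k \<le> sum (multiplicity_of p) {1..k})"
    using assms by (simp add: parking_function_def)
  also have "\<dots> \<longleftrightarrow> (\<forall>k\<le>n. k \<le> sum (multiplicity_of p) {1..k})"
    by (force simp: Suc_le_eq)
  finally show ?thesis .
qed

lemma step_vector_Phi_step:
  "step_vector (Phi_step p j) = (1, int (min 2 (multiplicity_of p j)) - 1)"
  by (auto simp: Phi_step_def)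

lemma path_point_Phi:
  assumes "k \<le> n"
  shows "path_point (Phi n p) k = (int k, int (\<Sum>j=1..k. min 2 (multiplicity_of p j)) - int k)"
proof -
  have "take k (Phi n p) = map (Phi_step p) [1..<Suc k]"
    using assms by (simp add: Phi_def take_map del: upt_Suc)
  then have "path_point (Phi n p) k = (\<Sum>j=1..k. step_vector (Phi_step p j))"
    by (simp add: path_point_def interv_sum_list_conv_sum_set_nat comp_def
        atLeastLessThanSuc_atLeastAtMost del: upt_Suc)
  then show ?thesis
    by (simp add: step_vector_Phi_step sum_prod sum_subtractf)
qed

lemma motzkin_path_Phi_iff:
  "motzkin_path n (Phi n p) \<longleftrightarrow>
     (\<Sum>j=1..n. min 2 (multiplicity_of p j)) = n \<and>
     (\<forall>k\<le>n. k \<le> (\<Sum>j=1..k. min 2 (multiplicity_of p j)))"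
proof -
  have "length (Phi n p) = n" by (simp add: Phi_def)
  then show ?thesis
    by (auto simp: motzkin_path_def path_point_Phi simp del: of_nat_sum)
qed

theorem theorem3p2:
  fixes n :: nat and p :: "nat list"
  assumes "p \<in> parking_preferences n"
  shows "motzkin_parking_function n p \<longleftrightarrow> motzkin_path n (Phi n p)"
proof -
  let ?m = "multiplicity_of p"
  have "(\<Sum>j=1..n. min 2 (?m j)) = n \<longleftrightarrow> (\<forall>j\<in>{1..n}. ?m j \<le> 2)"
    using sum_min_eq_iff[of "{1..n}" "\<lambda>_. 2" ?m] sum_multiplicity_of_eq_length[OF assms] by simp
  moreover have "(\<Sum>j=1..k. min 2 (?m j)) = sum ?m {1..k}"
    if "\<forall>j\<in>{1..n}. ?m j \<le> 2" and "k \<le> n" for k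
    using that by (intro sum.cong) auto
  ultimately have "motzkin_path n (Phi n p) \<longleftrightarrow>
      (\<forall>j\<in>{1..n}. ?m j \<le> 2) \<and> (\<forall>k\<le>n. k \<le> sum ?m {1..k})"
    unfolding motzkin_path_Phi_iff by auto
  then show ?thesis
    using parking_function_iff_le_sum_multiplicity_of[OF assms]
    by (auto simp: motzkin_parking_function_def)
qed

end
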